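(* Let $G$ be an $\alpha$-weakly-Helly graph and $M\subseteq V(G)$. Let $y\in V(G)\setminus C_G^{\alpha}(M)$, let $x\in C_G^{\alpha}(M)$ be a vertex of $C_G^{\alpha}(M)$ closest to $y$, and let $P(y,x)$ be any shortest path from $y$ to $x$. Then $2\,\mathbb{U}(P(y,x))+\mathbb{H}(P(y,x))\le 2\alpha$.
   Context: All graphs are finite, simple, undirected, unweighted and connected. A graph $G$ is $\alpha$-weakly-Helly if for every family of pairwise intersecting disks $\{D_G(v,r(v)) : v\in S\}$ (where $D_G(v,r)=\{u: d_G(u,v)\le r\}$) the disks $D_G(v,r(v)+\alpha)$, $v\in S$, have a common vertex. $e_G^M(v)=\max_{u\in M}d_G(v,u)$, $rad_G(M)=\min_{v\in V(G)}e_G^M(v)$, $C_G^{\ell}(M)=\{v: e_G^M(v)\le rad_G(M)+\ell\}$. Traversing a path from $y$ towards $x$, a consecutive pair $(u,v)$ of adjacent vertices is an up-edge if $e_G^M(u)<e_G^M(v)$, a horizontal-edge if $e_G^M(u)=e_G^M(v)$, and a down-edge if $e_G^M(u)>e_G^M(v)$; $\mathbb{U}(P)$ and $\mathbb{H}(P)$ denote the numbers of up-edges and horizontal-edges along $P$. *)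

theory Defs
  imports Graph_Theory.Graph_Theory
begin

text \<open>
  A finite simple undirected graph is a graph in the sense of \<^locale>\<open>graph\<close>: a finite,
  loop-free, symmetric digraph without parallel arcs, every undirected edge being represented
  by its two opposite arcs.  A path is a list of consecutive arcs with pairwise distinct vertices.
\<close>

definition gdist :: "('a, 'b) pre_digraph \<Rightarrow> 'a \<Rightarrow> 'a \<Rightarrow> nat" where
  "gdist G u v = (LEAST n. \<exists>p. pre_digraph.apath G u p v \<and> length p = n)"

text \<open>On connected graphs this is the library's shortest-path cost for unit weights.\<close>

lemma (in wf_digraph) gdist_eq_unit_cost:
  assumes "u \<rightarrow>\<^sup>* v"
  shows "ereal (real (gdist G u v)) = \<mu> (\<lambda>_. 1) u v"
proof -
  have cost: "awalk_cost (\<lambda>_. 1) p = real (length p)" for p :: "'b list"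
    by (induct p) auto
  from assms obtain p0 where p0: "apath u p0 v"
    using reachable_apath by blast
  have "\<exists>p. apath u p v \<and> length p = gdist G u v"
    unfolding gdist_def by (rule LeastI_ex) (use p0 in blast)
  then obtain p where p: "apath u p v" "length p = gdist G u v"
    by blast
  have least: "gdist G u v \<le> length q" if "apath u q v" for q
    unfolding gdist_def by (rule Least_le) (use that in blast)
  have "\<mu> (\<lambda>_. 1) u v = (INF q\<in>{q. apath u q v}. ereal (awalk_cost (\<lambda>_. 1) q))"
  proof (rule antisym)
    show "\<mu> (\<lambda>_. 1) u v \<le> (INF q\<in>{q. apath u q v}. ereal (awalk_cost (\<lambda>_. 1) q))"
      unfolding \<mu>_def by (rule INF_superset_mono) (auto intro: awalkI_apath)
    show "(INF q\<in>{q. apath u q v}. ereal (awalk_cost (\<lambda>_. 1) q)) \<le> \<mu> (\<lambda>_. 1) u v"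
      unfolding \<mu>_def
    proof (rule INF_greatest)
      fix q assume "q \<in> {q. awalk u q v}"
      then have q: "awalk u q v" by simp
      show "(INF q\<in>{q. apath u q v}. ereal (awalk_cost (\<lambda>_. 1) q)) \<le> ereal (awalk_cost (\<lambda>_. 1) q)"
      proof (rule ccontr)
        assume "\<not> ?thesis"
        then have "ereal (awalk_cost (\<lambda>_. 1) q) < (INF q\<in>{q. apath u q v}. ereal (awalk_cost (\<lambda>_. 1) q))"
          by simp
        from walk_cheaper_path_imp_neg_cyc[OF q this] show False
          by (auto simp: cost)
      qed
    qed
  qed
  also have "\<dots> = ereal (real (gdist G u v))"
  proof (rule antisym)
    show "(INF q\<in>{q. apath u q v}. ereal (awalk_cost (\<lambda>_. 1) q)) \<le> ereal (real (gdist G u v))"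
      by (rule INF_lower2[of p]) (use p in \<open>auto simp: cost\<close>)
    show "ereal (real (gdist G u v)) \<le> (INF q\<in>{q. apath u q v}. ereal (awalk_cost (\<lambda>_. 1) q))"
      by (rule INF_greatest) (use least in \<open>auto simp: cost\<close>)
  qed
  finally show ?thesis by simp
qed

definition disk :: "('a, 'b) pre_digraph \<Rightarrow> 'a \<Rightarrow> nat \<Rightarrow> 'a set" where
  "disk G v r = {u \<in> verts G. gdist G u v \<le> r}"

definition weakly_Helly :: "nat \<Rightarrow> ('a, 'b) pre_digraph \<Rightarrow> bool" where
  "weakly_Helly \<alpha> G \<longleftrightarrow>
     (\<forall>S r. S \<subseteq> verts G \<longrightarrow>
        (\<forall>u\<in>S. \<forall>v\<in>S. disk G u (r u) \<inter> disk G v (r v) \<noteq> {}) \<longrightarrow>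
        (\<exists>c\<in>verts G. \<forall>v\<in>S. c \<in> disk G v (r v + \<alpha>)))"

text \<open>
  Eccentricity and radius are meaningful only for nonempty \<open>M\<close>.  For empty \<open>M\<close> the value
  \<^term>\<open>Max {}\<close> does not depend on the vertex, so every vertex then lies in every
  \<open>center\<close> below.
\<close>

definition ecc :: "('a, 'b) pre_digraph \<Rightarrow> 'a set \<Rightarrow> 'a \<Rightarrow> nat" where
  "ecc G M v = Max ((\<lambda>u. gdist G v u) ` M)"

definition rad :: "('a, 'b) pre_digraph \<Rightarrow> 'a set \<Rightarrow> nat" where
  "rad G M = Min (ecc G M ` verts G)"

definition center :: "('a, 'b) pre_digraph \<Rightarrow> nat \<Rightarrow> 'a set \<Rightarrow> 'a set" where
  "center G l M = {v \<in> verts G. ecc G M v \<le> rad G M + l}"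

definition shortest_path :: "('a, 'b) pre_digraph \<Rightarrow> 'a \<Rightarrow> 'b list \<Rightarrow> 'a \<Rightarrow> bool" where
  "shortest_path G u p v \<longleftrightarrow> pre_digraph.apath G u p v \<and> length p = gdist G u v"

text \<open>
  Arcs of a path from \<open>y\<close> to \<open>x\<close> are directed from \<open>y\<close> towards \<open>x\<close>, so the tail and the head of
  an arc are the first and second vertex of the corresponding consecutive pair.
\<close>

definition up_edges :: "('a, 'b) pre_digraph \<Rightarrow> 'a set \<Rightarrow> 'b list \<Rightarrow> nat" where
  "up_edges G M p = length (filter (\<lambda>e. ecc G M (tail G e) < ecc G M (head G e)) p)"

definition horizontal_edges :: "('a, 'b) pre_digraph \<Rightarrow> 'a set \<Rightarrow> 'b list \<Rightarrow> nat" where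
  "horizontal_edges G M p = length (filter (\<lambda>e. ecc G M (tail G e) = ecc G M (head G e)) p)"

end

theory Submission
  imports Defs
begin

text \<open>
  Eccentricity changes by at most \<open>1\<close> along an edge, so \<open>2\<close> for an up-edge, \<open>1\<close> for a
  horizontal edge and \<open>0\<close> for a down-edge is at most \<open>1\<close> plus the change.  Summing along the path,
  the left-hand side is at most \<open>d(y,x) + e(x) - e(y)\<close>.  As \<open>e(x) \<le> rad + \<alpha>\<close>, it remains to see that
  \<open>d(y,x) \<le> e(y) - rad + \<alpha>\<close>.  This follows by applying the weak Helly property to the pairwise
  intersecting disks of radius \<open>rad\<close> around the vertices of \<open>M\<close> and the disk of radius
  \<open>e(y) - rad\<close> around \<open>y\<close>: the common vertex of the enlarged disks lies in \<open>C\<^sup>\<alpha>(M)\<close>.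
\<close>

text \<open>\<open>gdist\<close> minimises over paths only. Cutting the cycles out of a walk leaves
  a path, and with unit costs no cycle is negative, so the path is no longer than the walk.\<close>

lemma (in wf_digraph) gdist_le_awalk:
  assumes "awalk u p v"
  shows "gdist G u v \<le> length p"
proof -
  have cost: "awalk_cost (\<lambda>_. 1) q = real (length q)" for q :: "'b list"
    by (induct q) auto
  have "gdist G u v \<le> length (awalk_to_apath p)"
    unfolding gdist_def using apath_awalk_to_apath[OF assms] by (blast intro: Least_le)
  also have "length (awalk_to_apath p) \<le> length p"
    using awalk_to_path_no_neg_cyc_cost[OF assms, of "\<lambda>_. 1"] by (auto simp: cost)
  finally show ?thesis .
qed

lemma (in wf_digraph) gdist_awalk:
  assumes "u \<rightarrow>\<^sup>* v"
  obtains p where "awalk u p v" "length p = gdist G u v"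
proof -
  have "\<exists>p. apath u p v \<and> length p = gdist G u v"
    unfolding gdist_def by (rule LeastI_ex) (use assms reachable_apath in blast)
  then show thesis
    using that awalkI_apath by blast
qed

lemma (in wf_digraph) gdist_triangle:
  assumes "u \<rightarrow>\<^sup>* v" "v \<rightarrow>\<^sup>* w"
  shows "gdist G u w \<le> gdist G u v + gdist G v w"
  using assms gdist_le_awalk[OF awalk_appendI] by (metis gdist_awalk length_append)

text \<open>Cut a shortest walk after \<open>a\<close> arcs. If it has fewer, \<open>take a\<close>
  keeps all of it and the cut vertex is \<open>v\<close> itself.\<close>

lemma (in wf_digraph) gdist_split:
  assumes "u \<rightarrow>\<^sup>* v" "gdist G u v \<le> a + b"
  obtains w where "w \<in> verts G" "gdist G u w \<le> a" "gdist G w v \<le> b"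
proof -
  obtain p where p: "awalk u p v" "length p = gdist G u v"
    using gdist_awalk[OF assms(1)] .
  let ?w = "awlast u (take a p)"
  have "awalk u (take a p @ drop a p) v"
    using p(1) by simp
  then have w: "awalk u (take a p) ?w" "awalk ?w (drop a p) v"
    unfolding awalk_append_iff by blast+
  show thesis
  proof (rule that)
    show "?w \<in> verts G"
      using w(1) by blast
    show "gdist G u ?w \<le> a"
      using gdist_le_awalk[OF w(1)] by simp
    show "gdist G ?w v \<le> b"
      using gdist_le_awalk[OF w(2)] p(2) assms(2) by simp
  qed
qed

lemma (in sym_digraph) awalk_reverse:
  assumes "awalk u p v"
  shows "\<exists>q. awalk v q u \<and> length q = length p"
  using assms
proof (induct p arbitrary: u)
  case Nil
  then show ?case by (auto simp: awalk_Nil_iff)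
next
  case (Cons e p)
  then have e: "e \<in> arcs G" "tail G e = u" and "awalk (head G e) p v"
    by (auto simp: awalk_Cons_iff)
  then obtain q where q: "awalk v q (head G e)" "length q = length p"
    using Cons.hyps by blast
  obtain e' where "e' \<in> arcs G" "tail G e' = head G e" "head G e' = u"
    using e sym_arcs unfolding symmetric_conv by metis
  then have "awalk (head G e) [e'] u"
    by (auto simp: awalk_Cons_iff awalk_Nil_iff)
  then have "awalk v (q @ [e']) u"
    using q(1) by (rule awalk_appendI[rotated])
  then show ?case
    using q(2) by (intro exI[of _ "q @ [e']"]) simp
qed

lemma (in sym_digraph) gdist_sym:
  assumes "u \<rightarrow>\<^sup>* v"
  shows "gdist G u v = gdist G v u"
proof -
  have "gdist G b a \<le> gdist G a b" if "a \<rightarrow>\<^sup>* b" for a b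
    using gdist_awalk[OF that] awalk_reverse gdist_le_awalk by metis
  then show ?thesis
    using assms symmetric_reachable' by (metis antisym)
qed

lemma ecc_le_iff:
  assumes "finite M" "M \<noteq> {}"
  shows "ecc G M v \<le> k \<longleftrightarrow> (\<forall>u\<in>M. gdist G v u \<le> k)"
  using assms by (simp add: ecc_def)

lemma (in pseudo_graph) ecc_tail_le_ecc_head:
  assumes "connected G" "M \<subseteq> verts G" "M \<noteq> {}" "e \<in> arcs G"
  shows "ecc G M (tail G e) \<le> ecc G M (head G e) + 1"
proof -
  have fin: "finite M"
    using assms(2) finite_verts finite_subset by blast
  have reach: "u \<rightarrow>\<^sup>* v" if "u \<in> verts G" "v \<in> verts G" for u v
    using symmetric_connected_imp_strongly_connected[OF sym_arcs assms(1)] that by blast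
  have edge: "gdist G (tail G e) (head G e) \<le> 1"
    using gdist_le_awalk[of "tail G e" "[e]" "head G e"] assms(4)
    by (auto simp: awalk_Cons_iff awalk_Nil_iff)
  have "gdist G (tail G e) u \<le> ecc G M (head G e) + 1" if "u \<in> M" for u
  proof -
    have "gdist G (tail G e) u \<le> gdist G (tail G e) (head G e) + gdist G (head G e) u"
      using that assms by (intro gdist_triangle reach) auto
    moreover have "gdist G (head G e) u \<le> ecc G M (head G e)"
      using ecc_le_iff[OF fin assms(3)] that by blast
    ultimately show ?thesis
      using edge by simp
  qed
  then show ?thesis
    using ecc_le_iff[OF fin assms(3)] by blast
qed

text \<open>The summation along the path; having \<open>ecc\<close> on both sides avoids truncated
  subtraction, since the change may be negative.\<close>

lemma (in pseudo_graph) up_horizontal_edges_le: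
  assumes "connected G" "M \<subseteq> verts G" "M \<noteq> {}" "awalk u p v"
  shows "2 * up_edges G M p + horizontal_edges G M p + ecc G M u \<le> length p + ecc G M v"
  using assms(4)
proof (induct p arbitrary: u)
  case Nil
  then show ?case
    by (auto simp: up_edges_def horizontal_edges_def awalk_Nil_iff)
next
  case (Cons e p)
  then have e: "e \<in> arcs G" "tail G e = u" and "awalk (head G e) p v"
    by (auto simp: awalk_Cons_iff)
  then have "2 * up_edges G M p + horizontal_edges G M p + ecc G M (head G e)
      \<le> length p + ecc G M v"
    using Cons.hyps by blast
  \<comment> \<open>This bound serves the down-edges. For an up-edge, integrality gives a gain of at
    least 1, which with the arc itself pays for the weight 2.\<close>
  moreover have "ecc G M u \<le> ecc G M (head G e) + 1"
    using ecc_tail_le_ecc_head[OF assms(1-3) e(1)] e(2) by simp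
  ultimately show ?case
    using e(2) by (auto simp: up_edges_def horizontal_edges_def)
qed

lemma (in pseudo_graph) gdist_center_le:
  assumes "connected G" "weakly_Helly \<alpha> G" "M \<subseteq> verts G" "M \<noteq> {}" "y \<in> verts G"
  shows "\<exists>c\<in>center G \<alpha> M. gdist G y c + rad G M \<le> ecc G M y + \<alpha>"
proof -
  have fin: "finite M"
    using assms(3) finite_verts finite_subset by blast
  note ecc_le = ecc_le_iff[OF fin assms(4)]
  have reach: "u \<rightarrow>\<^sup>* v" if "u \<in> verts G" "v \<in> verts G" for u v
    using symmetric_connected_imp_strongly_connected[OF sym_arcs assms(1)] that by blast
  have "rad G M \<in> ecc G M ` verts G"
    unfolding rad_def using assms(5) by (intro Min_in) auto
  then obtain c0 where c0: "c0 \<in> verts G" "ecc G M c0 = rad G M"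
    by auto
  have rad_le: "rad G M \<le> ecc G M y"
    unfolding rad_def using assms(5) by (intro Min_le) auto
  \<comment> \<open>By \<open>rad_le\<close> the subtraction is exact, so
    \<open>k + rad G M = ecc G M y\<close>.\<close>
  define k where "k = ecc G M y - rad G M"
  \<comment> \<open>\<open>y\<close> may itself belong to \<open>M\<close> and then carries both radii, so take the smaller one.\<close>
  define r where "r v = (if v = y \<and> (y \<in> M \<longrightarrow> k < rad G M) then k else rad G M)" for v
  \<comment> \<open>Pairwise intersection needs each radius to be one of the intended two; the final
    estimates need only the upper bounds \<open>r_M\<close> and \<open>r_y\<close>, which both hold
    at \<open>y\<close> even if \<open>y\<close> lies in \<open>M\<close>.\<close>
  have r_cases: "v \<in> M \<and> r v = rad G M \<or> v = y \<and> r v = k" if "v \<in> insert y M" for v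
    using that by (auto simp: r_def)
  have r_M: "r v \<le> rad G M" if "v \<in> M" for v
    using that by (auto simp: r_def)
  have r_y: "r y \<le> k"
    by (auto simp: r_def)
  \<comment> \<open>The vertex \<open>c0\<close> attaining the radius lies in all of these
    disks.\<close>
  have M_M: "disk G u (rad G M) \<inter> disk G v (rad G M) \<noteq> {}" if "u \<in> M" "v \<in> M" for u v
    using ecc_le[of G c0 "rad G M"] c0 that by (auto simp: disk_def)
  have y_M: "disk G y k \<inter> disk G v (rad G M) \<noteq> {}" if "v \<in> M" for v
  proof -
    have "gdist G y v \<le> k + rad G M"
      using ecc_le[of G y "ecc G M y"] that rad_le by (simp add: k_def)
    then obtain w where "w \<in> verts G" "gdist G y w \<le> k" "gdist G w v \<le> rad G M"
      using gdist_split reach assms(3,5) \<open>v \<in> M\<close> by (metis subsetD)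
    \<comment> \<open>Disks measure distance towards their centre, so the bound from
      \<open>y\<close> to \<open>w\<close> has to be reversed.\<close>
    then show ?thesis
      using gdist_sym[OF reach] assms(5) by (auto simp: disk_def)
  qed
  have y_y: "disk G y k \<inter> disk G y k \<noteq> {}"
    using gdist_le_awalk[of y "[]" y] assms(5) by (auto simp: disk_def awalk_Nil_iff)
  have "\<forall>u\<in>insert y M. \<forall>v\<in>insert y M. disk G u (r u) \<inter> disk G v (r v) \<noteq> {}"
    using r_cases M_M y_M y_y by (metis Int_commute)
  moreover have "insert y M \<subseteq> verts G"
    using assms(3,5) by blast
  ultimately obtain c where c: "c \<in> verts G" "\<forall>v\<in>insert y M. c \<in> disk G v (r v + \<alpha>)"
    using assms(2) unfolding weakly_Helly_def by blast
  have "\<forall>v\<in>M. gdist G c v \<le> rad G M + \<alpha>"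
    using c(2) r_M by (fastforce simp: disk_def)
  then have "c \<in> center G \<alpha> M"
    using c(1) by (simp add: center_def ecc_le)
  moreover have "gdist G y c \<le> k + \<alpha>"
    using c r_y gdist_sym[OF reach, OF assms(5)] by (fastforce simp: disk_def)
  ultimately show ?thesis
    using rad_le by (intro bexI[of _ c]) (simp_all add: k_def)
qed

theorem theorem8:
  fixes G :: "('a, 'b) pre_digraph" and M :: "'a set" and \<alpha> :: nat
    and x y :: 'a and P :: "'b list"
  assumes "graph G" and "connected G"
    and "weakly_Helly \<alpha> G"
    and "M \<subseteq> verts G"
    and "y \<in> verts G - center G \<alpha> M"
    and "x \<in> center G \<alpha> M"
    and "\<forall>z \<in> center G \<alpha> M. gdist G y x \<le> gdist G y z"
    and "shortest_path G y P x"
  shows "2 * up_edges G M P + horizontal_edges G M P \<le> 2 * \<alpha>"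
proof -
  interpret graph G by fact
  have y: "y \<in> verts G"
    using assms(5) by blast
  \<comment> \<open>For empty \<open>M\<close> the eccentricity is constant, so it equals the radius
    and \<open>y\<close> would be in the center.\<close>
  have "M \<noteq> {}"
  proof
    assume "M = {}"
    then have "ecc G M = (\<lambda>_. Max {})"
      by (auto simp: ecc_def)
    moreover have "verts G \<noteq> {}"
      using y by blast
    ultimately have "y \<in> center G \<alpha> M"
      using y by (simp add: center_def rad_def image_constant_conv)
    then show False
      using assms(5) by blast
  qed
  obtain c where "c \<in> center G \<alpha> M" "gdist G y c + rad G M \<le> ecc G M y + \<alpha>"
    using gdist_center_le[OF assms(2-4) \<open>M \<noteq> {}\<close> y] by blast
  \<comment> \<open>\<open>x\<close> is at least as close to \<open>y\<close> as \<open>c\<close>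
    is, so the bound for \<open>c\<close> passes to \<open>x\<close>.\<close>
  then have "gdist G y x + rad G M \<le> ecc G M y + \<alpha>"
    using assms(7) by fastforce
  moreover have "ecc G M x \<le> rad G M + \<alpha>"
    using assms(6) by (simp add: center_def)
  moreover have "awalk y P x" and "length P = gdist G y x"
    using assms(8) by (auto simp: shortest_path_def awalkI_apath)
  ultimately show ?thesis
    using up_horizontal_edges_le[OF assms(2,4) \<open>M \<noteq> {}\<close>, of y P x] by linarith
qed

end
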